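(* Let $p\ge 1$, let $H\in\mathbb{R}^{p\times p}$ be symmetric positive semidefinite with $H_{ii}=1$ for all $i$, let $a\in\mathbb{R}^p$, $r_i>0$ for $i=1,\dots,p$, and let $f(x)=\tfrac12 x^\top Hx-a^\top x$ on the box $\mathcal{B}=\prod_{i=1}^p[0,r_i]$. Let $g_*$ be the common value of the gradient $Hx_*-a$ at all minimizers $x_*$ of $f$ over $\mathcal{B}$. Let $m_1,\dots,m_p$ satisfy $0\le m_i\le|g_{*,i}|$ for every $i$, and define $$M_{\rm scr}:=H+2\,\mathrm{diag}(m_1/r_1,\dots,m_p/r_p).$$ Then: (1) For every $x\in\mathcal{B}$ and every minimizer $x_*$ of $f$ over $\mathcal{B}$, $$\Delta(x)\ \ge\ \tfrac12(x-x_* )^\top M_{\rm scr}(x-x_* ).$$ (2) With $F=\{i:m_i=0\}$ and $H_{FF}$ the principal submatrix of $H$ indexed by $F$, one has $M_{\rm scr}\succ0$ if and only if $H_{FF}\succ0$ (the latter condition being vacuously true when $F=\varnothing$). (3) If $M_{\rm scr}\succ0$, then for every $\theta\in(0,1)$ and every $x\in\mathcal{B}$, $$\Delta(\mathcal{C}(x))\le\frac{A_\theta}{1+A_\theta}\,\Delta(x),\qquad A_\theta:=\frac{\lambda_{\max}\!\left(T(H+\theta M_{\rm scr})^{-1}T^\top\right)}{1-\theta}.$$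
   Context: $S\succ0$ means $S$ is symmetric positive definite; $\lambda_{\max}$ is the largest eigenvalue of a symmetric matrix. $f_*=\min_{x\in\mathcal{B}}f(x)$, $\Delta(x)=f(x)-f_*$, $g(x)=Hx-a$. All minimizers of $f$ over $\mathcal{B}$ have the same gradient, so $g_*$ is well defined. Cyclic sweep: given $x\in\mathcal{B}$, put $x^0=x$; for $i=1,\dots,p$, $x^i$ agrees with $x^{i-1}$ except in coordinate $i$, where $x^i_i=\min\{r_i,\max\{0,\,x^{i-1}_i-g_i(x^{i-1})\}\}$ (the exact minimizer of $f$ in coordinate $i$ over $[0,r_i]$, since $H_{ii}=1$). Then $\mathcal{C}(x):=x^p$. $T$ is the strictly lower triangular part of $H$: $T_{ij}=H_{ij}$ for $i>j$ and $T_{ij}=0$ for $i\le j$, so $H=I+T+T^\top$. *)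

theory Defs
  imports "HOL-Analysis.Analysis"
begin

text \<open>Coordinates are indexed by an arbitrary finite linearly ordered type \<open>'n\<close>, i.e. by
  \<open>{1, \<dots>, p}\<close> with \<open>p = CARD('n) \<ge> 1\<close>; the order fixes the order of the cyclic sweep
  and the meaning of ``lower triangular''. The box \<open>[0,r\<^sub>1] \<times> \<dots> \<times> [0,r\<^sub>p]\<close> is
  \<open>cbox 0 r\<close>.\<close>

definition pos_semidef :: "real^'n^'n \<Rightarrow> bool" where
  "pos_semidef A \<longleftrightarrow> transpose A = A \<and> (\<forall>v. 0 \<le> v \<bullet> (A *v v))"

definition pos_def :: "real^'n^'n \<Rightarrow> bool" where
  "pos_def A \<longleftrightarrow> transpose A = A \<and> (\<forall>v. v \<noteq> 0 \<longrightarrow> 0 < v \<bullet> (A *v v))"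

text \<open>Positive definiteness of the principal submatrix with index set \<open>I\<close>. The submatrix is
  the family \<open>A $ i $ j\<close> with \<open>i, j \<in> I\<close>, and only the values of \<open>v\<close> on \<open>I\<close> enter.\<close>

definition pos_def_on :: "'n set \<Rightarrow> real^'n^'n \<Rightarrow> bool" where
  "pos_def_on I A \<longleftrightarrow>
     (\<forall>i\<in>I. \<forall>j\<in>I. A $ i $ j = A $ j $ i) \<and>
     (\<forall>v::'n \<Rightarrow> real. (\<exists>i\<in>I. v i \<noteq> 0) \<longrightarrow>
        0 < (\<Sum>i\<in>I. \<Sum>j\<in>I. v i * A $ i $ j * v j))"

definition diag_mat :: "real^'n \<Rightarrow> real^'n^'n" where
  "diag_mat d = (\<chi> i j. if i = j then d $ i else 0)"

definition strict_lower :: "real^'n::{finite,linorder}^'n::_ \<Rightarrow> real^'n::_^'n::_" where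
  "strict_lower A = (\<chi> i j. if j < i then A $ i $ j else 0)"

definition is_eigenvalue :: "real^'n^'n \<Rightarrow> real \<Rightarrow> bool" where
  "is_eigenvalue A l \<longleftrightarrow> (\<exists>v. v \<noteq> 0 \<and> A *v v = l *\<^sub>R v)"

text \<open>Meaningful for symmetric \<open>A\<close>, whose (real) spectrum is finite and nonempty.\<close>

definition lambda_max :: "real^'n^'n \<Rightarrow> real" where
  "lambda_max A = (GREATEST l. is_eigenvalue A l)"

definition quad :: "real^'n^'n \<Rightarrow> real^'n \<Rightarrow> real^'n \<Rightarrow> real" where
  "quad H a x = (1/2) * (x \<bullet> (H *v x)) - a \<bullet> x"

definition grad :: "real^'n^'n \<Rightarrow> real^'n \<Rightarrow> real^'n \<Rightarrow> real^'n" where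
  "grad H a x = H *v x - a"

text \<open>The minimum is attained and the gradient is the same at all minimizers, so the descriptions
  in \<open>box_min\<close> and \<open>grad_star\<close> are well defined: see \<open>minimizer_exists\<close>, \<open>box_min_eq\<close> and
  \<open>grad_star_eq\<close> below.\<close>

definition box_min :: "real^'n^'n \<Rightarrow> real^'n \<Rightarrow> real^'n \<Rightarrow> real" where
  "box_min H a r = (LEAST v. v \<in> quad H a ` cbox 0 r)"

definition minimizer :: "real^'n^'n \<Rightarrow> real^'n \<Rightarrow> real^'n \<Rightarrow> real^'n \<Rightarrow> bool" where
  "minimizer H a r x \<longleftrightarrow> is_arg_min (quad H a) (\<lambda>y. y \<in> cbox 0 r) x"

definition gap :: "real^'n^'n \<Rightarrow> real^'n \<Rightarrow> real^'n \<Rightarrow> real^'n \<Rightarrow> real" where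
  "gap H a r x = quad H a x - box_min H a r"

definition grad_star :: "real^'n^'n \<Rightarrow> real^'n \<Rightarrow> real^'n \<Rightarrow> real^'n" where
  "grad_star H a r = (THE g. \<forall>x. minimizer H a r x \<longrightarrow> grad H a x = g)"

definition coord_step ::
    "real^'n^'n \<Rightarrow> real^'n \<Rightarrow> real^'n \<Rightarrow> 'n \<Rightarrow> real^'n \<Rightarrow> real^'n" where
  "coord_step H a r i x =
     (\<chi> j. if j = i then min (r $ i) (max 0 (x $ i - grad H a x $ i)) else x $ j)"

definition sweep ::
    "real^'n::{finite,linorder}^'n::_ \<Rightarrow> real^'n::_ \<Rightarrow> real^'n::_
       \<Rightarrow> real^'n::_ \<Rightarrow> real^'n::_" where
  "sweep H a r x = fold (coord_step H a r) (sorted_list_of_set UNIV) x"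

definition M_scr :: "real^'n^'n \<Rightarrow> real^'n \<Rightarrow> real^'n \<Rightarrow> real^'n^'n" where
  "M_scr H r m = H + 2 *\<^sub>R diag_mat (\<chi> i. m $ i / r $ i)"

definition A_const ::
    "real^'n::{finite,linorder}^'n::_ \<Rightarrow> real^'n::_^'n::_ \<Rightarrow> real \<Rightarrow> real" where
  "A_const H M \<theta> =
     lambda_max (strict_lower H ** matrix_inv (H + \<theta> *\<^sub>R M) ** transpose (strict_lower H))
       / (1 - \<theta>)"

lemma pos_def_on_UNIV: "pos_def_on UNIV A \<longleftrightarrow> pos_def A"
proof -
  have quadform: "v \<bullet> (A *v v) = (\<Sum>i\<in>UNIV. \<Sum>j\<in>UNIV. v $ i * A $ i $ j * v $ j)" for v
    by (simp add: inner_vec_def matrix_vector_mult_def sum_distrib_left mult.assoc)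
  have sym: "transpose A = A \<longleftrightarrow> (\<forall>i j. A $ i $ j = A $ j $ i)"
    by (auto simp: transpose_def vec_eq_iff)
  have "(\<forall>v::'a \<Rightarrow> real. (\<exists>i. v i \<noteq> 0) \<longrightarrow>
           0 < (\<Sum>i\<in>UNIV. \<Sum>j\<in>UNIV. v i * A $ i $ j * v j)) \<longleftrightarrow>
        (\<forall>v. v \<noteq> 0 \<longrightarrow> 0 < v \<bullet> (A *v v))" (is "?L \<longleftrightarrow> ?R")
  proof
    assume L: ?L
    show ?R
    proof (intro allI impI)
      fix v :: "real^'a" assume "v \<noteq> 0"
      then show "0 < v \<bullet> (A *v v)"
        using L[rule_format, of "\<lambda>i. v $ i"] by (auto simp: quadform vec_eq_iff)
    qed
  next
    assume R: ?R
    show ?L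
    proof (intro allI impI)
      fix v :: "'a \<Rightarrow> real" assume "\<exists>i. v i \<noteq> 0"
      then show "0 < (\<Sum>i\<in>UNIV. \<Sum>j\<in>UNIV. v i * A $ i $ j * v j)"
        using R[rule_format, of "\<chi> i. v i"] by (auto simp: quadform vec_eq_iff)
    qed
  qed
  then show ?thesis
    by (simp add: pos_def_on_def pos_def_def sym)
qed

lemma minimizer_exists:
  assumes "\<And>i. 0 \<le> r $ i"
  shows "\<exists>x. minimizer H a r x"
proof -
  have "continuous_on (cbox 0 r) (quad H a)"
    unfolding quad_def by (intro continuous_intros linear_continuous_on
        matrix_vector_mul_bounded_linear)
  moreover have "cbox 0 r \<noteq> {}"
    using assms by (auto simp: interval_ne_empty_cart)
  ultimately obtain x where "x \<in> cbox 0 r" "\<forall>y\<in>cbox 0 r. quad H a x \<le> quad H a y"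
    using continuous_attains_inf[OF compact_cbox] by blast
  then show ?thesis
    by (auto simp: minimizer_def is_arg_min_def not_less)
qed

lemma box_min_eq:
  assumes "minimizer H a r x"
  shows "box_min H a r = quad H a x"
  unfolding box_min_def using assms
  by (intro Least_equality) (auto simp: minimizer_def is_arg_min_def not_less)

lemma minimizers_same_grad:
  assumes psd: "pos_semidef H" and x: "minimizer H a r x" and y: "minimizer H a r y"
  shows "grad H a x = grad H a y"
proof -
  define d where "d = y - x"
  have sym: "u \<bullet> (H *v w) = w \<bullet> (H *v u)" for u w
    using psd by (metis dot_lmul_matrix inner_commute pos_semidef_def transpose_matrix_vector)
  have q: "quad H a (x + t *\<^sub>R d) =
      quad H a x + t * (d \<bullet> (H *v x) - a \<bullet> d) + t\<^sup>2 / 2 * (d \<bullet> (H *v d))" for t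
    by (simp add: quad_def matrix_vector_right_distrib matrix_vector_mult_scaleR
        inner_add_left inner_add_right sym[of x d] algebra_simps power2_eq_square)
  have mid: "x + (1/2) *\<^sub>R d \<in> cbox 0 r"
    using x y by (auto simp: minimizer_def is_arg_min_def mem_box_cart d_def field_simps)
      (smt (verit))+
  have xy: "quad H a y = quad H a x"
    using x y by (auto simp: minimizer_def is_arg_min_def not_less intro: antisym)
  have "quad H a x \<le> quad H a (x + (1/2) *\<^sub>R d)"
    using x mid by (auto simp: minimizer_def is_arg_min_def not_less)
  moreover have "quad H a (x + 1 *\<^sub>R d) = quad H a x"
    using xy by (simp add: d_def)
  moreover have "v \<le> 0" if "c \<le> c + 1/2 * u + (1/2)\<^sup>2 / 2 * v" "c + 1 * u + 1\<^sup>2 / 2 * v = c"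
    for c u v :: real
    using that by (simp add: power2_eq_square)
  ultimately have le: "d \<bullet> (H *v d) \<le> 0"
    unfolding q by blast
  define w where "w = H *v d"
  define c where "c = w \<bullet> (H *v w)"
  have pos: "0 \<le> (d - t *\<^sub>R w) \<bullet> (H *v (d - t *\<^sub>R w))" for t
    using psd by (auto simp: pos_semidef_def)
  have exp: "(d - t *\<^sub>R w) \<bullet> (H *v (d - t *\<^sub>R w)) =
      d \<bullet> (H *v d) - 2 * t * (w \<bullet> w) + t\<^sup>2 * c" for t
    by (simp add: c_def matrix_vector_mult_diff_distrib matrix_vector_mult_scaleR
        inner_diff_left inner_diff_right sym[of d w] power2_eq_square flip: w_def)
      (simp add: algebra_simps)
  have c0: "0 \<le> c" using psd by (auto simp: c_def pos_semidef_def)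
  have "w \<bullet> w \<le> 0"
  proof (rule ccontr)
    assume n: "\<not> w \<bullet> w \<le> 0"
    define t where "t = (w \<bullet> w) / (c + 1)"
    have t0: "0 < t" unfolding t_def using n c0 by (intro divide_pos_pos) linarith+
    have "0 \<le> t * (t * c - 2 * (w \<bullet> w))"
      using pos[of t] le unfolding exp by (simp add: power2_eq_square algebra_simps)
    then have "2 * (w \<bullet> w) \<le> t * c"
      using t0 by (simp add: zero_le_mult_iff)
    also have "\<dots> \<le> t * (c + 1)" using t0 by simp
    also have "\<dots> = w \<bullet> w" using c0 by (simp add: t_def)
    finally show False using n by simp
  qed
  then have "w = 0" by (metis inner_eq_zero_iff inner_ge_zero order_antisym)
  then show ?thesis
    by (simp add: grad_def w_def d_def matrix_vector_mult_diff_distrib)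
qed

lemma grad_star_eq:
  assumes "pos_semidef H" and "minimizer H a r x"
  shows "grad_star H a r = grad H a x"
  unfolding grad_star_def
  using assms minimizers_same_grad[OF assms(1)] by (intro the_equality) blast+

end

theory Submission
  imports Defs
begin

text \<open>Optimality at a minimizer \<open>x\<^sub>*\<close> holds coordinatewise, so the linear part of the gap is
  \<open>\<Sum>\<^sub>i \<bar>g\<^sub>*\<^sub>i\<bar> \<bar>x\<^sub>i - x\<^sub>*\<^sub>i\<bar>\<close>, and \<open>\<bar>x\<^sub>i - x\<^sub>*\<^sub>i\<bar> \<le> r\<^sub>i\<close> makes it dominate the diagonal part
  of \<open>M\<^sub>s\<^sub>c\<^sub>r\<close>. For the rate, let \<open>y = C(x)\<close>, \<open>d = y - x\<close>, \<open>u = x\<^sub>* - y\<close>. A sweep decreases \<open>f\<close> by at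
  least \<open>\<parallel>d\<parallel>\<^sup>2/2\<close>, and the partial derivatives seen by the sweep are the entries of
  \<open>\<gamma> = g(y) - T\<^sup>T d\<close>, which satisfies \<open>\<gamma> \<bullet> u \<ge> 0\<close>. Hence
  \<open>\<Delta>(y) \<le> - (T\<^sup>T d) \<bullet> u - u\<^sup>T H u / 2\<close>. Subtracting \<open>\<theta>\<close> times the quadratic growth bound and
  completing the square in \<open>u\<close> gives
  \<open>(1 - \<theta>) \<Delta>(y) \<le> d\<^sup>T T (H + \<theta> M\<^sub>s\<^sub>c\<^sub>r)\<^sup>-\<^sup>1 T\<^sup>T d / 2 \<le> \<lambda>\<^sub>m\<^sub>a\<^sub>x (\<Delta>(x) - \<Delta>(y))\<close>.\<close>

section \<open>Symmetric matrices: null vectors, the largest eigenvalue, inverses\<close>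

lemma inner_matrix_transpose:
  fixes A :: "real^'n^'m"
  shows "u \<bullet> (A *v w) = (transpose A *v u) \<bullet> w"
  by (simp add: dot_lmul_matrix)

lemma inner_symmetric_matrix:
  fixes A :: "real^'n^'n"
  assumes "transpose A = A"
  shows "u \<bullet> (A *v w) = w \<bullet> (A *v u)"
  by (metis assms inner_commute inner_matrix_transpose)

lemma quadratic_form_add:
  fixes A :: "real^'n^'n"
  assumes "transpose A = A"
  shows "(u + w) \<bullet> (A *v (u + w)) = u \<bullet> (A *v u) + 2 * (w \<bullet> (A *v u)) + w \<bullet> (A *v w)"
  using inner_symmetric_matrix[OF assms, of u w]
  by (simp add: matrix_vector_right_distrib inner_add_left inner_add_right)

text \<open>Moving from \<open>v\<close> against \<open>A *v v\<close> would make the form negative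
  to first order unless that vector is zero.\<close>

lemma pos_semidef_null:
  fixes A :: "real^'n^'n"
  assumes "pos_semidef A" "v \<bullet> (A *v v) = 0"
  shows "A *v v = 0"
proof -
  have sym: "transpose A = A" and psd: "\<And>v. 0 \<le> v \<bullet> (A *v v)"
    using assms(1) by (auto simp: pos_semidef_def)
  define w where "w = A *v v"
  have q: "0 \<le> t * (2 * (w \<bullet> w) + t * (w \<bullet> (A *v w)))" for t
    using psd[of "v + t *\<^sub>R w"] assms(2) unfolding quadratic_form_add[OF sym]
    by (simp add: w_def[symmetric] matrix_vector_mult_scaleR algebra_simps)
  have "w \<bullet> w \<le> 0"
  proof (rule ccontr)
    assume n: "\<not> w \<bullet> w \<le> 0"
    define c where "c = w \<bullet> (A *v w)"
    have c: "0 \<le> c" using psd by (simp add: c_def)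
    \<comment> \<open>A negative \<open>t\<close> turns \<open>q\<close> into
      \<open>2 * (w \<bullet> w) + t * c \<le> 0\<close>, but here the left side is
      \<open>(w \<bullet> w) - t > 0\<close>. The denominator \<open>c + 1\<close> covers
      \<open>c = 0\<close>.\<close>
    define t where "t = - ((w \<bullet> w) / (c + 1))"
    have "0 < (w \<bullet> w) / (c + 1)" using n c by (intro divide_pos_pos) auto
    then have t: "t < 0" by (simp add: t_def)
    have "2 * (w \<bullet> w) + t * c \<le> 0"
      using q[of t] t by (simp add: zero_le_mult_iff c_def)
    moreover have "t * c = - (w \<bullet> w) - t" using c by (simp add: t_def field_simps)
    ultimately show False using n t by linarith
  qed
  then have "w \<bullet> w = 0" using inner_ge_zero[of w] by linarith
  then show ?thesis by (simp add: w_def)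
qed

text \<open>The maximum \<open>l\<close> of the form over the unit sphere is itself an eigenvalue
  and bounds all others, so it is the value that \<open>GREATEST\<close> picks.\<close>

lemma rayleigh_le_lambda_max:
  fixes S :: "real^'n^'n"
  assumes sym: "transpose S = S"
  shows "v \<bullet> (S *v v) \<le> lambda_max S * (v \<bullet> v)"
proof -
  have "continuous_on (sphere 0 1) (\<lambda>v. v \<bullet> (S *v v))"
    by (intro continuous_intros linear_continuous_on matrix_vector_mul_bounded_linear)
  moreover have "sphere (0::real^'n) 1 \<noteq> {}" by simp
  ultimately obtain u where u: "norm u = 1"
    and max: "\<And>v. norm v = 1 \<Longrightarrow> v \<bullet> (S *v v) \<le> u \<bullet> (S *v u)"
    using continuous_attains_sup[OF compact_sphere, of 0 1 "\<lambda>v. v \<bullet> (S *v v)"] by auto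
  define l where "l = u \<bullet> (S *v u)"
  have bound: "v \<bullet> (S *v v) \<le> l * (v \<bullet> v)" for v
  proof (cases "v = 0")
    case False
    define w where "w = (1 / norm v) *\<^sub>R v"
    have "norm w = 1" using False by (simp add: w_def)
    have "v \<bullet> (S *v v) = (v \<bullet> v) * (w \<bullet> (S *v w))"
      using False by (simp add: w_def matrix_vector_mult_scaleR field_simps
          flip: power2_norm_eq_inner power2_eq_square)
    also have "\<dots> \<le> (v \<bullet> v) * l"
      using max[OF \<open>norm w = 1\<close>] by (intro mult_left_mono) (auto simp: l_def)
    finally show ?thesis by (simp add: mult.commute)
  qed simp
  \<comment> \<open>By \<open>bound\<close>, \<open>B\<close> is positive semidefinite, and its form
    vanishes at \<open>u\<close>; \<open>pos_semidef_null\<close> then makes \<open>u\<close> an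
    eigenvector of \<open>S\<close>.\<close>
  define B where "B = l *\<^sub>R mat 1 - S"
  have B: "B *v v = l *\<^sub>R v - S *v v" for v
    by (simp add: B_def matrix_vector_mult_diff_rdistrib scaleR_matrix_vector_assoc[symmetric])
  have "pos_semidef B"
    unfolding pos_semidef_def
  proof
    show "transpose B = B"
      using sym by (auto simp: B_def transpose_def vec_eq_iff mat_def)
    show "\<forall>v. 0 \<le> v \<bullet> (B *v v)"
      using bound by (simp add: B inner_diff_right)
  qed
  moreover have "u \<bullet> (B *v u) = 0"
    using u by (simp add: B inner_diff_right l_def norm_eq_1)
  ultimately have "S *v u = l *\<^sub>R u"
    using pos_semidef_null[of B u] by (simp add: B)
  then have "is_eigenvalue S l"
    using u by (auto simp: is_eigenvalue_def intro!: exI[of _ u])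
  moreover have "k \<le> l" if k: "is_eigenvalue S k" for k
  proof -
    obtain w where "w \<noteq> 0" "S *v w = k *\<^sub>R w"
      using k by (auto simp: is_eigenvalue_def)
    then show ?thesis using bound[of w] by (simp add: mult_le_cancel_right)
  qed
  ultimately have "lambda_max S = l"
    unfolding lambda_max_def by (intro Greatest_equality) auto
  then show ?thesis using bound by simp
qed

lemma lambda_max_nonneg:
  fixes S :: "real^'n^'n"
  assumes "pos_semidef S"
  shows "0 \<le> lambda_max S"
proof -
  obtain u :: "real^'n" where "norm u = 1" using vector_choose_size[of 1] by auto
  then have "u \<bullet> (S *v u) \<le> lambda_max S"
    using rayleigh_le_lambda_max[of S u] assms by (simp add: pos_semidef_def norm_eq_1)
  then show ?thesis using assms by (auto simp: pos_semidef_def intro: order_trans)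
qed

lemma pos_def_invertible:
  fixes K :: "real^'n^'n"
  assumes "pos_def K"
  shows "invertible K"
proof -
  have "K *v v = 0 \<Longrightarrow> v = 0" for v
    using assms by (metis inner_zero_right less_irrefl pos_def_def)
  then show ?thesis
    by (simp add: invertible_left_inverse matrix_left_invertible_ker)
qed

lemma matrix_inv_right:
  fixes K :: "real^'n^'n"
  assumes "invertible K"
  shows "K ** matrix_inv K = mat 1"
  using someI_ex[OF assms[unfolded invertible_def]] by (simp add: matrix_inv_def)

lemma matrix_inv_mult_vector:
  fixes K :: "real^'n^'n"
  assumes "invertible K"
  shows "K *v (matrix_inv K *v w) = w"
  by (simp add: matrix_vector_mul_assoc matrix_inv_right[OF assms])

lemma pos_semidef_congruence_inverse:
  fixes K :: "real^'n^'n" and T :: "real^'n^'m"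
  assumes "pos_def K"
  shows "pos_semidef (T ** matrix_inv K ** transpose T)"
proof -
  have inv: "invertible K" and sym: "transpose K = K"
    using assms by (auto simp: pos_def_invertible pos_def_def)
  have pos: "0 \<le> v \<bullet> (K *v v)" for v
    using assms by (cases "v = 0") (auto simp: pos_def_def less_imp_le)
  \<comment> \<open>By symmetry of \<open>K\<close>, the transposed inverse is a left inverse, hence
    equal to the right inverse \<open>matrix_inv K\<close>.\<close>
  have "transpose (matrix_inv K) ** K = mat 1"
    by (metis inv matrix_inv_right matrix_transpose_mul sym transpose_mat)
  then have isym: "transpose (matrix_inv K) = matrix_inv K"
    by (metis inv matrix_inv_right matrix_mul_assoc matrix_mul_lid matrix_mul_rid)
  have "v \<bullet> (matrix_inv K *v v) \<ge> 0" for v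
    using pos[of "matrix_inv K *v v"]
    by (simp add: matrix_inv_mult_vector[OF inv] inner_commute)
  then have "0 \<le> v \<bullet> ((T ** matrix_inv K ** transpose T) *v v)" for v
    by (simp add: matrix_vector_mul_assoc[symmetric] inner_matrix_transpose[of v T])
  then show ?thesis
    by (simp add: pos_semidef_def matrix_transpose_mul isym matrix_mul_assoc)
qed

text \<open>The right side minus the left side is half the form of \<open>K\<close> at
  \<open>u + matrix_inv K *v w\<close>.\<close>

lemma complete_square_bound:
  fixes K :: "real^'n^'n"
  assumes "pos_def K"
  shows "- (w \<bullet> u) - (1/2) * (u \<bullet> (K *v u)) \<le> (1/2) * (w \<bullet> (matrix_inv K *v w))"
proof -
  have inv: "invertible K" and sym: "transpose K = K"
    using assms by (auto simp: pos_def_invertible pos_def_def)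
  define z where "z = matrix_inv K *v w"
  have z: "K *v z = w" by (simp add: z_def matrix_inv_mult_vector[OF inv])
  have "0 \<le> (z + u) \<bullet> (K *v (z + u))"
    using assms by (cases "z + u = 0") (auto simp: pos_def_def less_imp_le)
  then show ?thesis
    unfolding quadratic_form_add[OF sym] z by (simp add: z_def inner_commute)
qed

section \<open>Expansion of the objective and first-order optimality on the box\<close>

lemma quad_add:
  assumes "transpose H = H"
  shows "quad H a (x + d) = quad H a x + grad H a x \<bullet> d + (1/2) * (d \<bullet> (H *v d))"
  unfolding quad_def grad_def quadratic_form_add[OF assms]
  by (simp add: inner_diff_left inner_add_right inner_commute algebra_simps)

lemma quad_add_axis:
  assumes "transpose H = H" "H $ i $ i = 1"
  shows "quad H a (x + s *\<^sub>R axis i 1) = quad H a x + s * grad H a x $ i + s\<^sup>2 / 2"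
  unfolding quad_add[OF assms(1)]
  by (simp add: matrix_vector_mult_scaleR matrix_vector_mult_basis inner_axis
      inner_axis' column_def assms power2_eq_square)

lemma minimizer_cbox:
  "minimizer H a r x \<Longrightarrow> x \<in> cbox 0 r"
  by (simp add: minimizer_def is_arg_min_def)

lemma minimizer_le:
  "minimizer H a r x \<Longrightarrow> y \<in> cbox 0 r \<Longrightarrow> quad H a x \<le> quad H a y"
  by (auto simp: minimizer_def is_arg_min_def not_less)

text \<open>If the product were negative, a short step along axis \<open>i\<close> towards
  \<open>s\<close> would stay in the box and lower the objective.\<close>

lemma minimizer_variational:
  assumes sym: "transpose H = H" and diag: "H $ i $ i = 1"
    and x: "minimizer H a r x" and s: "0 \<le> s" "s \<le> r $ i"
  shows "0 \<le> grad H a x $ i * (s - x $ i)"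
proof (rule ccontr)
  define e where "e = s - x $ i"
  define b where "b = grad H a x $ i * e"
  assume "\<not> ?thesis"
  then have b: "b < 0" by (simp add: b_def e_def)
  \<comment> \<open>The cap 1 keeps the step in the box by convexity; the other bound keeps
    \<open>t * e\<^sup>2\<close> below \<open>- b\<close>, so \<open>b + t * e\<^sup>2 / 2\<close>
    stays negative.\<close>
  define t where "t = min 1 (- b / (e\<^sup>2 + 1))"
  have "0 < - b / (e\<^sup>2 + 1)" using b by (intro divide_pos_pos) (auto simp: add_nonneg_pos)
  then have t: "0 < t" "t \<le> 1" by (auto simp: t_def)
  have te: "t * (e\<^sup>2 + 1) \<le> - b"
    by (simp add: pos_le_divide_eq[symmetric] add_nonneg_pos t_def)
  have xb: "0 \<le> x $ j" "x $ j \<le> r $ j" for j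
    using minimizer_cbox[OF x] by (auto simp: mem_box_cart)
  have "x $ i + t * e = (1 - t) * x $ i + t * s" by (simp add: e_def algebra_simps)
  moreover have "0 \<le> (1 - t) * x $ i + t * s" using t s xb by simp
  moreover have "(1 - t) * x $ i + t * s \<le> r $ i"
    using t s xb by (intro convex_bound_le) auto
  ultimately have "x + (t * e) *\<^sub>R axis i 1 \<in> cbox 0 r"
    using xb by (auto simp: mem_box_cart axis_def)
  from minimizer_le[OF x this]
  have "0 \<le> t * b + t * (t * e\<^sup>2) / 2"
    unfolding quad_add_axis[OF sym diag] by (simp add: b_def power2_eq_square algebra_simps)
  also have "\<dots> = t * (b + t * e\<^sup>2 / 2)" by (simp add: algebra_simps)
  finally have "0 \<le> b + t * e\<^sup>2 / 2" using t by (simp add: zero_le_mult_iff)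
  moreover have "0 \<le> t * e\<^sup>2" using t by simp
  ultimately show False using te t b by (simp add: algebra_simps)
qed

section \<open>The matrix \<open>M_scr\<close>: quadratic growth and definiteness\<close>

lemma transpose_M_scr: "transpose H = H \<Longrightarrow> transpose (M_scr H r m) = M_scr H r m"
  by (auto simp: M_scr_def diag_mat_def transpose_def vec_eq_iff)

lemma M_scr_form:
  "v \<bullet> (M_scr H r m *v v) = v \<bullet> (H *v v) + 2 * (\<Sum>i\<in>UNIV. m $ i / r $ i * (v $ i)\<^sup>2)"
proof -
  have "(diag_mat d *v v) $ i = d $ i * v $ i" for i and d v :: "real^'a"
    by (simp add: matrix_vector_mult_def diag_mat_def if_distrib[of "\<lambda>x. x * _"] cong: if_cong)
  then show ?thesis
    by (simp add: M_scr_def matrix_vector_mult_add_rdistrib scaleR_matrix_vector_assoc[symmetric]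
        inner_add_right) (simp add: inner_vec_def power2_eq_square ac_simps)
qed

lemma gap_quadratic_growth:
  assumes H: "pos_semidef H" and diag: "\<And>i. H $ i $ i = 1" and r: "\<And>i. 0 < r $ i"
    and m: "\<And>i. m $ i \<le> \<bar>grad_star H a r $ i\<bar>" "\<And>i. 0 \<le> m $ i"
    and x: "x \<in> cbox 0 r" and xs: "minimizer H a r xs"
  shows "gap H a r x \<ge> (1/2) * ((x - xs) \<bullet> (M_scr H r m *v (x - xs)))"
proof -
  have sym: "transpose H = H" using H by (simp add: pos_semidef_def)
  define g where "g = grad H a xs"
  have g: "grad_star H a r = g" using grad_star_eq[OF H xs] by (simp add: g_def)
  have xb: "0 \<le> x $ i" "x $ i \<le> r $ i" "0 \<le> xs $ i" "xs $ i \<le> r $ i" for i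
    using x minimizer_cbox[OF xs] by (auto simp: mem_box_cart)
  have "m $ i / r $ i * ((x - xs) $ i)\<^sup>2 \<le> g $ i * (x - xs) $ i" for i
  proof -
    define e where "e = (x - xs) $ i"
    have "0 \<le> g $ i * e"
      using minimizer_variational[OF sym diag xs xb(1,2)] by (simp add: g_def e_def)
    \<comment> \<open>\<open>m\<close> is compared with the absolute gradient entry, so signs must
      go. The side length then trades one factor \<open>\<bar>e\<bar>\<close> for
      \<open>r $ i\<close>, which produces the weight \<open>m $ i / r $ i\<close>.\<close>
    then have ge: "g $ i * e = \<bar>g $ i\<bar> * \<bar>e\<bar>" by (simp add: abs_mult[symmetric])
    have "\<bar>e\<bar> \<le> r $ i" using xb[of i] by (auto simp: e_def)
    then have "\<bar>e\<bar> * \<bar>e\<bar> \<le> r $ i * \<bar>e\<bar>" by (intro mult_right_mono) auto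
    then have "e\<^sup>2 / r $ i \<le> \<bar>e\<bar>"
      using r[of i] by (simp add: pos_divide_le_eq power2_eq_square mult.commute)
    then have "m $ i * (e\<^sup>2 / r $ i) \<le> \<bar>g $ i\<bar> * \<bar>e\<bar>"
      using m[of i] r[of i] by (intro mult_mono) (auto simp: g)
    then show ?thesis unfolding e_def[symmetric] by (simp add: ge)
  qed
  then have "(\<Sum>i\<in>UNIV. m $ i / r $ i * ((x - xs) $ i)\<^sup>2) \<le> g \<bullet> (x - xs)"
    by (simp add: inner_vec_def sum_mono)
  moreover have "gap H a r x = g \<bullet> (x - xs) + (1/2) * ((x - xs) \<bullet> (H *v (x - xs)))"
    using quad_add[OF sym, of a xs "x - xs"] by (simp add: gap_def box_min_eq[OF xs] g_def)
  ultimately show ?thesis by (simp add: M_scr_form)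
qed

lemma sum_restrict_form:
  fixes H :: "real^'n^'n" and v :: "real^'n"
  assumes "\<And>i. i \<notin> F \<Longrightarrow> v $ i = 0"
  shows "(\<Sum>i\<in>F. \<Sum>j\<in>F. v $ i * H $ i $ j * v $ j) = v \<bullet> (H *v v)"
proof -
  have "v \<bullet> (H *v v) = (\<Sum>i\<in>UNIV. \<Sum>j\<in>UNIV. v $ i * H $ i $ j * v $ j)"
    by (simp add: inner_vec_def matrix_vector_mult_def sum_distrib_left mult.assoc)
  also have "\<dots> = (\<Sum>i\<in>F. \<Sum>j\<in>UNIV. v $ i * H $ i $ j * v $ j)"
    using assms by (intro sum.mono_neutral_right) auto
  also have "\<dots> = (\<Sum>i\<in>F. \<Sum>j\<in>F. v $ i * H $ i $ j * v $ j)"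
    using assms by (intro sum.cong refl sum.mono_neutral_right) auto
  finally show ?thesis by simp
qed

text \<open>The diagonal part vanishes exactly on vectors supported where \<open>m\<close> is zero,
  and there the form is that of \<open>H\<close>. On all other vectors the diagonal part is positive
  and \<open>H\<close> contributes a nonnegative amount.\<close>

lemma pos_def_M_scr_iff:
  fixes H :: "real^'n^'n"
  assumes H: "pos_semidef H" and r: "\<And>i. 0 < r $ i" and m: "\<And>i. 0 \<le> m $ i"
  shows "pos_def (M_scr H r m) \<longleftrightarrow> pos_def_on {i. m $ i = 0} H"
proof
  have sym: "transpose H = H" and psd: "\<And>v. 0 \<le> v \<bullet> (H *v v)"
    using H by (auto simp: pos_semidef_def)
  have entry: "H $ i $ j = H $ j $ i" for i j
    by (metis sym transpose_def vec_lambda_beta)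
  let ?F = "{i. m $ i = 0}"
  {
    assume M: "pos_def (M_scr H r m)"
    show "pos_def_on ?F H"
      unfolding pos_def_on_def
    proof (intro conjI allI impI ballI)
      fix v :: "'n \<Rightarrow> real" assume v: "\<exists>i\<in>?F. v i \<noteq> 0"
      define w :: "real^'n" where "w = (\<chi> i. if m $ i = 0 then v i else 0)"
      have "w \<noteq> 0" using v by (auto simp: w_def vec_eq_iff)
      then have "0 < w \<bullet> (M_scr H r m *v w)" using M by (simp add: pos_def_def)
      moreover have "(\<Sum>i\<in>UNIV. m $ i / r $ i * (w $ i)\<^sup>2) = 0"
        by (intro sum.neutral) (auto simp: w_def)
      ultimately have "0 < w \<bullet> (H *v w)" by (simp add: M_scr_form)
      also have "\<dots> = (\<Sum>i\<in>?F. \<Sum>j\<in>?F. w $ i * H $ i $ j * w $ j)"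
        by (intro sum_restrict_form[symmetric]) (auto simp: w_def)
      finally show "0 < (\<Sum>i\<in>?F. \<Sum>j\<in>?F. v i * H $ i $ j * v j)"
        by (simp add: w_def)
    qed (rule entry)
  next
    assume F: "pos_def_on ?F H"
    show "pos_def (M_scr H r m)"
      unfolding pos_def_def
    proof (intro conjI allI impI)
      fix v :: "real^'n" assume v: "v \<noteq> 0"
      have terms: "0 \<le> m $ i / r $ i * (v $ i)\<^sup>2" for i
        using m[of i] r[of i] by simp
      show "0 < v \<bullet> (M_scr H r m *v v)"
      proof (cases "\<forall>i. i \<notin> ?F \<longrightarrow> v $ i = 0")
        case True
        then have "\<exists>i\<in>?F. v $ i \<noteq> 0" using v by (auto simp: vec_eq_iff)
        then have "0 < (\<Sum>i\<in>?F. \<Sum>j\<in>?F. v $ i * H $ i $ j * v $ j)"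
          using F by (auto simp: pos_def_on_def)
        also have "\<dots> = v \<bullet> (H *v v)" using True by (intro sum_restrict_form) auto
        finally show ?thesis
          using sum_nonneg[of UNIV "\<lambda>i. m $ i / r $ i * (v $ i)\<^sup>2"] terms by (simp add: M_scr_form)
      next
        case False
        then obtain i where "m $ i \<noteq> 0" "v $ i \<noteq> 0" by auto
        then have "0 < m $ i / r $ i * (v $ i)\<^sup>2" using m[of i] r[of i] by simp
        then have "0 < (\<Sum>i\<in>UNIV. m $ i / r $ i * (v $ i)\<^sup>2)"
          using terms by (intro sum_pos2[of _ i]) auto
        then show ?thesis using psd[of v] by (simp add: M_scr_form)
      qed
    qed (rule transpose_M_scr[OF sym])
  }
qed

section \<open>The cyclic sweep and its contraction rate\<close>

lemma coord_step_axis: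
  "coord_step H a r k y =
     y + (min (r $ k) (max 0 (y $ k - grad H a y $ k)) - y $ k) *\<^sub>R axis k 1"
  by (auto simp: coord_step_def vec_eq_iff axis_def)

text \<open>\<open>t + d\<close> is the projection of \<open>t - b\<close> onto the interval from 0
  to \<open>c\<close>, and \<open>b + d\<close> is their difference: the variational inequality of a
  projection.\<close>

lemma clamp_variational:
  fixes b c s t :: real
  assumes "0 \<le> s" "s \<le> c" "d = min c (max 0 (t - b)) - t"
  shows "0 \<le> (b + d) * (s - (t + d))"
  using assms by (auto simp: min_def max_def zero_le_mult_iff)

text \<open>Induction over prefixes of the sweep. The correction by
  \<open>transpose (strict_lower H)\<close> removes from gradient entry \<open>i\<close> the effect
  of coordinates moved after \<open>i\<close>, so the entry keeps the value it had right after its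
  own step and its inequality survives.\<close>

lemma sweep_invariant:
  fixes H :: "real^'n::{finite,linorder}^'n::_"
  assumes sym: "transpose H = H" and diag: "\<And>i. H $ i $ i = 1" and x: "x \<in> cbox 0 r"
    and "sorted_wrt (<) ks" and "y = fold (coord_step H a r) ks x"
  shows "y \<in> cbox 0 r \<and> (\<forall>j. j \<notin> set ks \<longrightarrow> y $ j = x $ j)
    \<and> quad H a x - quad H a y \<ge> (1/2) * ((y - x) \<bullet> (y - x))
    \<and> (\<forall>i\<in>set ks. \<forall>s. 0 \<le> s \<and> s \<le> r $ i \<longrightarrow>
         0 \<le> (grad H a y - transpose (strict_lower H) *v (y - x)) $ i * (s - y $ i))"
  using assms(4,5)
proof (induction ks arbitrary: y rule: rev_induct)
  case Nil
  then show ?case using x by simp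
next
  case (snoc k ks)
  have entry: "H $ i $ j = H $ j $ i" for i j
    by (metis sym transpose_def vec_lambda_beta)
  define z where "z = fold (coord_step H a r) ks x"
  define d where "d = min (r $ k) (max 0 (z $ k - grad H a z $ k)) - z $ k"
  let ?U = "transpose (strict_lower H)"
  have less: "\<And>i. i \<in> set ks \<Longrightarrow> i < k"
    using snoc.prems by (simp add: sorted_wrt_append)
  have y: "y = z + d *\<^sub>R axis k 1"
    using snoc.prems(2) coord_step_axis[of H a r k z] by (simp add: z_def d_def)
  have IH: "z \<in> cbox 0 r" "\<And>j. j \<notin> set ks \<Longrightarrow> z $ j = x $ j"
    "quad H a x - quad H a z \<ge> (1/2) * ((z - x) \<bullet> (z - x))"
    "\<And>i s. i \<in> set ks \<Longrightarrow> 0 \<le> s \<Longrightarrow> s \<le> r $ i \<Longrightarrow>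
       0 \<le> (grad H a z - ?U *v (z - x)) $ i * (s - z $ i)"
    using snoc.IH[OF _ z_def] snoc.prems by (auto simp: sorted_wrt_append)
  have zb: "0 \<le> z $ i" "z $ i \<le> r $ i" for i
    using IH(1) by (auto simp: mem_box_cart)
  have yk: "y $ k = z $ k + d" and yj: "\<And>j. j \<noteq> k \<Longrightarrow> y $ j = z $ j"
    by (auto simp: y axis_def)
  \<comment> \<open>Coordinate \<open>k\<close> is first moved now, so the new increment is
    orthogonal to \<open>z - x\<close> and squared lengths add.\<close>
  have zk: "z $ k = x $ k" using IH(2)[of k] less[of k] by blast
  have same: "y $ j = x $ j" if "j \<notin> set (ks @ [k])" for j
    using that IH(2) yj by simp
  have "0 \<le> z $ k + d" "z $ k + d \<le> r $ k"
    using zb[of k] by (auto simp: d_def)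
  then have "0 \<le> y $ i \<and> y $ i \<le> r $ i" for i
    using zb[of i] yk yj by (cases "i = k") auto
  then have box: "y \<in> cbox 0 r" by (simp add: mem_box_cart)
  have grad: "grad H a y $ i = grad H a z $ i + d * H $ i $ k" for i
    by (simp add: grad_def y matrix_vector_right_distrib matrix_vector_mult_scaleR
        matrix_vector_mult_basis column_def)
  have var: "0 \<le> (grad H a z $ k + d) * (s - (z $ k + d))" if "0 \<le> s" "s \<le> r $ k" for s
    using that by (intro clamp_variational[of _ "r $ k"]) (auto simp: d_def)
  \<comment> \<open>The old coordinate is an admissible \<open>s\<close>; the resulting inequality
    makes the step lower the objective by at least \<open>d\<^sup>2 / 2\<close>.\<close>
  have "0 \<le> (grad H a z $ k + d) * (z $ k - (z $ k + d))" using var zb by blast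
  then have dec: "d * grad H a z $ k + d\<^sup>2 \<le> 0" by (simp add: power2_eq_square algebra_simps)
  have "(y - x) \<bullet> (y - x) = (z - x) \<bullet> (z - x) + d\<^sup>2"
  proof -
    have "orthogonal (z - x) (d *\<^sub>R axis k 1)"
      using zk by (simp add: orthogonal_def inner_axis)
    then have "((z - x) + d *\<^sub>R axis k 1) \<bullet> ((z - x) + d *\<^sub>R axis k 1)
        = (z - x) \<bullet> (z - x) + d\<^sup>2"
      by (simp add: orthogonal_def inner_add_left inner_add_right inner_commute
          inner_axis_axis power2_eq_square)
    then show ?thesis by (simp add: y add_diff_eq diff_add_eq)
  qed
  then have decrease: "quad H a x - quad H a y \<ge> (1/2) * ((y - x) \<bullet> (y - x))"
    using IH(3) dec unfolding y quad_add_axis[OF sym diag] by (simp add: field_simps)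
  have "0 \<le> (grad H a y - ?U *v (y - x)) $ i * (s - y $ i)"
    if i: "i \<in> set (ks @ [k])" and s: "0 \<le> s" "s \<le> r $ i" for i s
  proof (cases "i = k")
    case True
    \<comment> \<open>Row \<open>k\<close> of \<open>?U\<close> sees only indices above
      \<open>k\<close>, none of them moved yet; what remains is the gradient entry after the step,
      the one in \<open>var\<close>.\<close>
    have "(?U *v (y - x)) $ k = (\<Sum>j\<in>UNIV. (if k < j then H $ j $ k else 0) * (y $ j - x $ j))"
      by (simp add: matrix_vector_mult_def transpose_def strict_lower_def)
    also have "\<dots> = 0"
    proof (rule sum.neutral, intro ballI)
      fix j
      have "j \<notin> set (ks @ [k])" if "k < j" using that less[of j] by auto
      then show "(if k < j then H $ j $ k else 0) * (y $ j - x $ j) = 0"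
        using same by auto
    qed
    finally show ?thesis using var s True by (simp add: grad diag yk)
  next
    case False
    then have i': "i \<in> set ks" "i < k" using i less by auto
    \<comment> \<open>The move along axis \<open>k\<close> changes the gradient entry and its
      correction by the same \<open>d * H $ i $ k\<close>, so their difference is unchanged.\<close>
    have "(?U *v axis k 1) $ i = H $ i $ k"
      using i'(2) by (simp add: matrix_vector_mult_basis column_def transpose_def
          strict_lower_def entry)
    moreover have "y - x = (z - x) + d *\<^sub>R axis k 1" by (simp add: y)
    ultimately have "(?U *v (y - x)) $ i = (?U *v (z - x)) $ i + d * H $ i $ k"
      by (simp only: matrix_vector_right_distrib matrix_vector_mult_scaleR vector_add_component
          vector_scaleR_component) simp
    then show ?thesis using IH(4)[OF i'(1) s] False by (simp add: grad yj)
  qed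
  then show ?case using box same decrease by blast
qed

text \<open>\<open>M\<close> enters only through its definiteness and the growth bound, so the rate
  holds for any such matrix.\<close>

lemma sweep_contraction:
  fixes H :: "real^'n::{finite,linorder}^'n::_" and a r x xs :: "real^'n::_"
    and M :: "real^'n::_^'n::_"
  assumes H: "pos_semidef H" and diag: "\<And>i. H $ i $ i = 1" and M: "pos_def M"
    and growth: "\<And>y. y \<in> cbox 0 r \<Longrightarrow> gap H a r y \<ge> (1/2) * ((y - xs) \<bullet> (M *v (y - xs)))"
    and xs: "minimizer H a r xs" and \<theta>: "0 < \<theta>" "\<theta> < 1" and x: "x \<in> cbox 0 r"
  shows "gap H a r (sweep H a r x) \<le> A_const H M \<theta> / (1 + A_const H M \<theta>) * gap H a r x"
proof -
  have sym: "transpose H = H" and psd: "\<And>v. 0 \<le> v \<bullet> (H *v v)"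
    using H by (auto simp: pos_semidef_def)
  define y where "y = sweep H a r x"
  define d where "d = y - x"
  define u where "u = xs - y"
  define T where "T = strict_lower H"
  define K where "K = H + \<theta> *\<^sub>R M"
  define S where "S = T ** matrix_inv K ** transpose T"
  define w where "w = transpose T *v d"
  have inv: "y \<in> cbox 0 r" "quad H a x - quad H a y \<ge> (1/2) * (d \<bullet> d)"
    "\<And>i s. 0 \<le> s \<Longrightarrow> s \<le> r $ i \<Longrightarrow> 0 \<le> (grad H a y - w) $ i * (s - y $ i)"
    using sweep_invariant[OF sym diag x _ refl, of "sorted_list_of_set UNIV" a]
    by (auto simp: y_def sweep_def d_def w_def T_def)
  have Kform: "v \<bullet> (K *v v) = v \<bullet> (H *v v) + \<theta> * (v \<bullet> (M *v v))" for v
    by (simp add: K_def matrix_vector_mult_add_rdistrib scaleR_matrix_vector_assoc[symmetric]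
        inner_add_right)
  have K: "pos_def K"
    unfolding pos_def_def
  proof (intro conjI allI impI)
    show "transpose K = K"
      using sym M by (auto simp: K_def pos_def_def transpose_def vec_eq_iff)
    show "0 < v \<bullet> (K *v v)" if "v \<noteq> 0" for v
      using that M psd[of v] \<theta> by (simp add: Kform pos_def_def add_nonneg_pos)
  qed
  have S: "pos_semidef S" unfolding S_def by (rule pos_semidef_congruence_inverse[OF K])
  \<comment> \<open>Each coordinate inequality is tested with \<open>s = xs $ i\<close>, then
    summed.\<close>
  have "0 \<le> (grad H a y - w) \<bullet> u"
    unfolding inner_vec_def using inv(3) minimizer_cbox[OF xs]
    by (intro sum_nonneg) (auto simp: u_def mem_box_cart)
  moreover have "gap H a r y = - (grad H a y \<bullet> u) - (1/2) * (u \<bullet> (H *v u))"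
    using quad_add[OF sym, of a y u] by (simp add: u_def gap_def box_min_eq[OF xs])
  ultimately have "gap H a r y \<le> - (w \<bullet> u) - (1/2) * (u \<bullet> (H *v u))"
    by (simp add: inner_diff_left)
  moreover have "(1/2) * (u \<bullet> (M *v u)) \<le> gap H a r y"
  proof -
    have "y - xs = - u" by (simp add: u_def)
    then show ?thesis using growth[OF inv(1)] by (simp add: vec.neg)
  qed
  \<comment> \<open>Giving up the fraction \<open>\<theta>\<close> of the gap replaces
    \<open>H\<close> by \<open>K\<close>, which is positive definite even if \<open>H\<close> is
    singular.\<close>
  then have "\<theta> * ((1/2) * (u \<bullet> (M *v u))) \<le> \<theta> * gap H a r y"
    using \<theta> by (intro mult_left_mono) auto
  ultimately have "(1 - \<theta>) * gap H a r y \<le> - (w \<bullet> u) - (1/2) * (u \<bullet> (K *v u))"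
    by (simp add: Kform algebra_simps)
  also have "\<dots> \<le> (1/2) * (w \<bullet> (matrix_inv K *v w))"
    by (rule complete_square_bound[OF K])
  also have "w \<bullet> (matrix_inv K *v w) = d \<bullet> (S *v d)"
    by (simp add: S_def w_def matrix_vector_mul_assoc[symmetric] inner_matrix_transpose[of d T])
  also have "(1/2) * (d \<bullet> (S *v d)) \<le> lambda_max S * ((1/2) * (d \<bullet> d))"
    using rayleigh_le_lambda_max[of S d] S by (simp add: pos_semidef_def)
  also have "\<dots> \<le> lambda_max S * (gap H a r x - gap H a r y)"
    using inv(2) lambda_max_nonneg[OF S] by (intro mult_left_mono) (auto simp: gap_def)
  finally have main: "(1 - \<theta>) * gap H a r y \<le> lambda_max S * (gap H a r x - gap H a r y)" .
  define A where "A = A_const H M \<theta>"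
  have A: "A = lambda_max S / (1 - \<theta>)"
    by (simp add: A_def A_const_def S_def T_def K_def)
  have A0: "0 \<le> A" using lambda_max_nonneg[OF S] \<theta> by (simp add: A)
  have "gap H a r y \<le> A * (gap H a r x - gap H a r y)"
    using main \<theta> by (simp add: A pos_le_divide_eq mult.commute)
  then have "gap H a r y * (1 + A) \<le> A * gap H a r x" by (simp add: algebra_simps)
  then show ?thesis
    using A0 by (simp add: y_def[symmetric] A_def[symmetric] pos_le_divide_eq)
qed

theorem mainTheorem6:
  fixes H :: "real^'n::{finite,linorder}^'n::_" and a r m :: "real^'n::_"
  assumes "pos_semidef H"
    and "\<And>i. H $ i $ i = 1"
    and "\<And>i. 0 < r $ i"
    and "\<And>i. 0 \<le> m $ i \<and> m $ i \<le> \<bar>grad_star H a r $ i\<bar>"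
  shows "(\<forall>x\<in>cbox 0 r. \<forall>xs. minimizer H a r xs \<longrightarrow>
            gap H a r x \<ge> (1/2) * ((x - xs) \<bullet> (M_scr H r m *v (x - xs))))
       \<and> (pos_def (M_scr H r m) \<longleftrightarrow> pos_def_on {i. m $ i = 0} H)
       \<and> (pos_def (M_scr H r m) \<longrightarrow>
            (\<forall>\<theta>::real. 0 < \<theta> \<and> \<theta> < 1 \<longrightarrow> (\<forall>x\<in>cbox 0 r.
               gap H a r (sweep H a r x) \<le>
                 A_const H (M_scr H r m) \<theta> / (1 + A_const H (M_scr H r m) \<theta>) * gap H a r x)))"
proof -
  have growth: "gap H a r x \<ge> (1/2) * ((x - xs) \<bullet> (M_scr H r m *v (x - xs)))"
    if "x \<in> cbox 0 r" "minimizer H a r xs" for x xs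
    using gap_quadratic_growth[OF assms(1-3)] assms(4) that by blast
  \<comment> \<open>The rate mentions no minimizer, but its proof measures growth from one; any
    choice will do.\<close>
  obtain xs where "minimizer H a r xs"
    using minimizer_exists assms(3) less_imp_le by metis
  with growth show ?thesis
    using pos_def_M_scr_iff[OF assms(1,3)] assms(4)
      sweep_contraction[OF assms(1,2)] by blast
qed

end
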